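(* Let $X$ be a path connected space. If $X$ is not homotopically path Hausdorff, then $X$ does not admit a simply connected covering space.
   Context: A covering $p:\widetilde{X}\to X$ is a continuous map such that every $x\in X$ has an open neighborhood $U$ that is evenly covered, i.e. $p^{-1}(U)$ is a disjoint union of open subsets of $\widetilde{X}$ each mapped homeomorphically onto $U$ by $p$; then $\widetilde{X}$ is called a covering space of $X$. All spaces and covering spaces are path connected; homotopies of paths are relative to endpoints. A space $X$ is homotopically path Hausdorff if for every two paths $w,v:[0,1]\to X$ with $w(0)=v(0)$ and $w(1)=v(1)$ that are not homotopic relative to endpoints, there exist a partition $0=t_0<t_1<\dots<t_n=1$ and open sets $U_1,\dots,U_n\subseteq X$ with $w([t_{i-1},t_i])\subseteq U_i$ for $1\le i\le n$, such that every path $u:[0,1]\to X$ with $u([t_{i-1},t_i])\subseteq U_i$ for $1\le i\le n$ and $u(t_i)=w(t_i)$ for $0\le i\le n$ is not homotopic to $v$ relative to endpoints. *)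

theory Defs
  imports "HOL-Analysis.Analysis"
begin

(* The space X is a set carrying the subspace topology of its ambient type, so "open in X"
   is openin (top_of_set X). Indices of the open sets are shifted by one: U i is the set
   belonging to the segment [t i, t (i+1)]. *)
definition homotopically_path_Hausdorff :: "'a::topological_space set \<Rightarrow> bool" where
  "homotopically_path_Hausdorff X \<longleftrightarrow>
    (\<forall>w v. path w \<and> path_image w \<subseteq> X \<and> path v \<and> path_image v \<subseteq> X \<and>
           pathstart w = pathstart v \<and> pathfinish w = pathfinish v \<and>
           \<not> homotopic_paths X w v \<longrightarrow>
       (\<exists>(n::nat) (t :: nat \<Rightarrow> real) (U :: nat \<Rightarrow> 'a set).
          t 0 = 0 \<and> t n = 1 \<and> (\<forall>i<n. t i < t (Suc i)) \<and>
          (\<forall>i<n. openin (top_of_set X) (U i) \<and> w ` {t i..t (Suc i)} \<subseteq> U i) \<and>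
          (\<forall>u. path u \<and> path_image u \<subseteq> X \<and>
               (\<forall>i<n. u ` {t i..t (Suc i)} \<subseteq> U i) \<and> (\<forall>i\<le>n. u (t i) = w (t i))
               \<longrightarrow> \<not> homotopic_paths X u v)))"

end

(* Suppose p : C \<rightarrow> X is a simply connected covering and the paths w, v witness that X is not
   homotopically path Hausdorff.  Their lifts w', v' from a common point end at different points of
   the fibre, since C is simply connected and w, v are not homotopic.  Choose a partition such that
   w' maps each segment into a sheet V i, and let U i = p(V i).  A path u inside the tube formed by
   the U i and meeting w at the partition points lifts segment by segment through the same sheets,
   so its lift ends where w' ends.  If u were homotopic to v, monodromy would make it end where v'
   ends. *)
theory Submission
  imports Defs
begin

section \<open>Unique lifts, lifts over rectangles, path lifting and monodromy\<close>

section \<open>Lifting to covering spaces of arbitrary topological spaces\<close>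

text \<open>Over an evenly covered neighbourhood the sheets are open, pairwise disjoint and mapped
  injectively by \<open>p\<close>. Near \<open>z\<close> each lift stays in its own sheet: in a
  common sheet the lifts agree throughout, in different sheets they differ throughout. So the truth
  value of agreement is locally constant, hence constant on the connected set
  \<open>T\<close>.\<close>

lemma covering_space_lift_unique_topological:
  fixes g1 g2 :: "'c::topological_space \<Rightarrow> 'b::topological_space" and p :: "'b \<Rightarrow> 'a::topological_space"
  assumes cov: "covering_space C p X" and conn: "connected T"
    and g1: "continuous_on T g1" "g1 ` T \<subseteq> C" and g2: "continuous_on T g2" "g2 ` T \<subseteq> C"
    and eq: "\<And>z. z \<in> T \<Longrightarrow> p (g1 z) = p (g2 z)"
    and a: "a \<in> T" "g1 a = g2 a" and x: "x \<in> T"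
  shows "g1 x = g2 x"
proof -
  have "\<forall>z\<in>T. eventually (\<lambda>y. (g1 z = g2 z) = (g1 y = g2 y)) (at z within T)"
  proof
    fix z assume z: "z \<in> T"
    then have "p (g1 z) \<in> X"
      using cov g1(2) unfolding covering_space_def by auto
    then obtain N \<V> where N: "p (g1 z) \<in> N" and \<V>: "\<Union>\<V> = C \<inter> p -` N"
      "\<And>u. u \<in> \<V> \<Longrightarrow> openin (top_of_set C) u" "pairwise disjnt \<V>"
      "\<And>u. u \<in> \<V> \<Longrightarrow> \<exists>q. homeomorphism u N p q"
      using cov unfolding covering_space_def by metis
    have "g1 z \<in> \<Union>\<V>" "g2 z \<in> \<Union>\<V>"
      using N z g1(2) g2(2) eq[OF z] \<V>(1) by auto
    then obtain u1 u2 where u: "u1 \<in> \<V>" "g1 z \<in> u1" "u2 \<in> \<V>" "g2 z \<in> u2"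
      by auto
    have evt: "eventually (\<lambda>y. g y \<in> u) (at z within T)"
      if g: "continuous_on T g" "g ` T \<subseteq> C" and "u \<in> \<V>" "g z \<in> u" for g u
    proof -
      obtain O' where O': "open O'" "u = C \<inter> O'"
        using \<V>(2)[OF \<open>u \<in> \<V>\<close>] by (auto simp: openin_open)
      have "eventually (\<lambda>y. g y \<in> O') (at z within T)"
        using g(1) z O' \<open>g z \<in> u\<close> unfolding continuous_on_def by (auto dest: topological_tendstoD)
      moreover have "eventually (\<lambda>y. y \<in> T) (at z within T)"
        by (auto simp: eventually_at_filter)
      ultimately show ?thesis
        by eventually_elim (use g(2) O' in auto)
    qed
    have inj: "inj_on p u" if "u \<in> \<V>" for u
      using \<V>(4)[OF that] unfolding homeomorphism_def by (metis inj_onI)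
    have "eventually (\<lambda>y. y \<in> T) (at z within T)"
      by (auto simp: eventually_at_filter)
    with evt[OF g1 u(1,2)] evt[OF g2 u(3,4)]
    show "eventually (\<lambda>y. (g1 z = g2 z) = (g1 y = g2 y)) (at z within T)"
    proof eventually_elim
      case (elim y)
      show ?case
      proof (cases "u1 = u2")
        case True
        then show ?thesis
          using inj[OF u(1)] elim u(2,4) eq z by (auto dest: inj_onD)
      next
        case False
        then have "disjnt u1 u2"
          using \<V>(3) u by (auto simp: pairwise_def)
        then show ?thesis
          using elim u by (metis disjnt_iff)
      qed
    qed
  qed
  from connected_local_const[OF conn a(1) x this] a(2) show ?thesis
    by simp
qed

text \<open>Every base point \<open>z\<close> and every point \<open>c\<close> of the fibre over it
  must be allowed. This is what lets lifts be glued: a lift over one piece can be continued over the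
  next from whatever value it has reached at a common point.\<close>

definition lifts_on :: "'b::topological_space set \<Rightarrow> ('b \<Rightarrow> 'a) \<Rightarrow> ('c::topological_space \<Rightarrow> 'a) \<Rightarrow> 'c set \<Rightarrow> bool" where
  "lifts_on C p h K \<longleftrightarrow>
    (\<forall>z\<in>K. \<forall>c\<in>C. p c = h z \<longrightarrow>
      (\<exists>k. continuous_on K k \<and> k ` K \<subseteq> C \<and> k z = c \<and> (\<forall>y\<in>K. p (k y) = h y)))"

lemma lifts_onE:
  assumes "lifts_on C p h K" "z \<in> K" "c \<in> C" "p c = h z"
  obtains k where "continuous_on K k" "k ` K \<subseteq> C" "k z = c" "\<And>y. y \<in> K \<Longrightarrow> p (k y) = h y"
  using assms unfolding lifts_on_def by blast

text \<open>A lift over \<open>S\<close> is continued over \<open>T\<close> from a common point.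
  Both lifts agree on all of \<open>S \<inter> T\<close> because this set is connected, and
  closedness of the two pieces makes the pasted map continuous.\<close>

lemma lifts_on_Un:
  fixes h :: "'c::topological_space \<Rightarrow> 'a::topological_space"
  assumes cov: "covering_space C p X"
    and lifts: "lifts_on C p h S" "lifts_on C p h T"
    and cl: "closed S" "closed T" and int: "connected (S \<inter> T)" "S \<inter> T \<noteq> {}"
  shows "lifts_on C p h (S \<union> T)"
proof -
  \<comment> \<open>The base point is taken in the first of the two sets; using the claim a second
    time with the sets swapped covers a base point in \<open>T\<close>. For this reason it restates
    the assumptions on \<open>S\<close> and \<open>T\<close>.\<close>
  have *: "\<exists>k. continuous_on (S \<union> T) k \<and> k ` (S \<union> T) \<subseteq> C \<and> k z = c \<and> (\<forall>y\<in>S \<union> T. p (k y) = h y)"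
    if lS: "lifts_on C p h S" and lT: "lifts_on C p h T" and cl: "closed S" "closed T"
      and int: "connected (S \<inter> T)" "S \<inter> T \<noteq> {}"
      and z: "z \<in> S" "c \<in> C" "p c = h z" for S T z c
  proof -
    obtain k1 where k1: "continuous_on S k1" "k1 ` S \<subseteq> C" "k1 z = c" "\<And>y. y \<in> S \<Longrightarrow> p (k1 y) = h y"
      using lifts_onE[OF lS z] by metis
    obtain z' where z': "z' \<in> S" "z' \<in> T"
      using int by auto
    have "k1 z' \<in> C" "p (k1 z') = h z'"
      using z' k1 by auto
    then obtain k2 where k2: "continuous_on T k2" "k2 ` T \<subseteq> C" "k2 z' = k1 z'" "\<And>y. y \<in> T \<Longrightarrow> p (k2 y) = h y"
      using lifts_onE[OF lT z'(2)] by metis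
    have agree: "k1 y = k2 y" if "y \<in> S \<inter> T" for y
    proof (rule covering_space_lift_unique_topological[OF cov int(1), of _ _ z'])
      show "continuous_on (S \<inter> T) k1" "continuous_on (S \<inter> T) k2"
        using k1(1) k2(1) by (auto intro: continuous_on_subset)
    qed (use k1 k2 z' that in auto)
    let ?k = "\<lambda>y. if y \<in> S then k1 y else k2 y"
    have "continuous_on (S \<union> T) ?k"
      by (rule continuous_on_cases[OF cl k1(1) k2(1)]) (use agree in auto)
    moreover have "?k ` (S \<union> T) \<subseteq> C"
      using k1(2) k2(2) by auto
    ultimately show ?thesis
      using z k1 k2 by (intro exI[of _ ?k]) auto
  qed
  show ?thesis
    unfolding lifts_on_def
  proof (intro ballI impI)
    fix z c assume "z \<in> S \<union> T" "c \<in> C" "p c = h z"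
    then show "\<exists>k. continuous_on (S \<union> T) k \<and> k ` (S \<union> T) \<subseteq> C \<and> k z = c \<and> (\<forall>y\<in>S \<union> T. p (k y) = h y)"
      using *[OF lifts cl int, of z c] *[OF lifts(2,1) cl(2,1), of z c] int
      by (auto simp: Un_commute Int_commute)
  qed
qed

text \<open>\<open>W\<close> is the preimage of an evenly covered set. If \<open>h\<close> maps
  \<open>K\<close> into that set, the inverse \<open>q\<close> of \<open>p\<close> on the sheet
  through \<open>c\<close>, composed with \<open>h\<close>, is a lift over \<open>K\<close>,
  whatever the shape of \<open>K\<close>.\<close>

lemma lifts_on_locally:
  fixes h :: "'c::topological_space \<Rightarrow> 'a::topological_space"
  assumes cov: "covering_space C p X" and h: "continuous_on UNIV h" "range h \<subseteq> X"
  obtains W where "open W" "z \<in> W" "\<And>K. K \<subseteq> W \<Longrightarrow> lifts_on C p h K"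
proof -
  obtain N \<V> where N: "h z \<in> N" "openin (top_of_set X) N" and \<V>: "\<Union>\<V> = C \<inter> p -` N"
    "\<And>u. u \<in> \<V> \<Longrightarrow> \<exists>q. homeomorphism u N p q"
    using cov h(2) unfolding covering_space_def by (metis rangeI subsetD)
  obtain O' where O': "open O'" "N = X \<inter> O'"
    using N(2) by (auto simp: openin_open)
  have "h -` O' \<inter> UNIV = h -` N"
    using O' h(2) by auto
  then have "open (h -` N)"
    using h(1) O'(1) by (metis Int_UNIV_right open_vimage)
  moreover have "lifts_on C p h K" if K: "K \<subseteq> h -` N" for K
    unfolding lifts_on_def
  proof (intro ballI impI)
    fix z c assume zc: "z \<in> K" "c \<in> C" "p c = h z"
    then have "c \<in> \<Union>\<V>"
      using K \<V>(1) by auto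
    then obtain u q where u: "u \<in> \<V>" "c \<in> u" and q: "homeomorphism u N p q"
      using \<V>(2) by blast
    have "continuous_on K (q \<circ> h)"
      using q K h(1) unfolding homeomorphism_def
      by (intro continuous_on_compose) (auto intro: continuous_on_subset)
    moreover have "u \<subseteq> C"
      using u \<V>(1) by blast
    then have "(q \<circ> h) ` K \<subseteq> C"
      using q K unfolding homeomorphism_def by fastforce
    moreover have "(q \<circ> h) z = c" "\<forall>y\<in>K. p ((q \<circ> h) y) = h y"
      using q K u zc unfolding homeomorphism_def by auto
    ultimately show "\<exists>k. continuous_on K k \<and> k ` K \<subseteq> C \<and> k z = c \<and> (\<forall>y\<in>K. p (k y) = h y)"
      by blast
  qed
  ultimately show ?thesis
    using that[of "h -` N"] N by auto
qed

text \<open>Bisection in each coordinate replaces a subdivision into small squares: rectangles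
  sharing a side are glued by \<open>lifts_on_Un\<close>, whose connected overlap is that side, and
  small rectangles around a point lift by \<open>lifts_on_locally\<close>.\<close>

lemma lifts_on_rectangle:
  fixes h :: "real \<times> real \<Rightarrow> 'a::topological_space"
  assumes cov: "covering_space C p X" and h: "continuous_on UNIV h" "range h \<subseteq> X"
    and "a \<le> b" "c \<le> d"
  shows "lifts_on C p h ({a..b} \<times> {c..d})"
  using \<open>a \<le> b\<close>
proof (induction rule: Bolzano)
  case (trans a b c')
  have "lifts_on C p h ({a..b} \<times> {c..d} \<union> {b..c'} \<times> {c..d})"
  proof (rule lifts_on_Un[OF cov trans(1,2)])
    have "{a..b} \<times> {c..d} \<inter> {b..c'} \<times> {c..d} = {b} \<times> {c..d}"
      using trans by auto
    then show "connected ({a..b} \<times> {c..d} \<inter> {b..c'} \<times> {c..d})" "{a..b} \<times> {c..d} \<inter> {b..c'} \<times> {c..d} \<noteq> {}"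
      using \<open>c \<le> d\<close> by (auto intro: connected_Times)
  qed (auto intro: closed_Times)
  moreover have "{a..b} \<times> {c..d} \<union> {b..c'} \<times> {c..d} = {a..c'} \<times> {c..d}"
    using trans by auto
  ultimately show ?case
    by simp
next
  case (local x)
  \<comment> \<open>With \<open>x\<close> fixed, the inner bisection runs over the second side. Its
    predicate says that some width works for all strips around \<open>x\<close> over the given
    interval; when two intervals are joined, the smaller of their widths works.\<close>
  show ?case
    using \<open>c \<le> d\<close>
  proof (induction rule: Bolzano)
    case (trans c d e)
    then obtain d1 d2 where d: "d1 > 0" "d2 > 0"
      "\<And>a b. a \<le> x \<Longrightarrow> x \<le> b \<Longrightarrow> b - a < d1 \<Longrightarrow> lifts_on C p h ({a..b} \<times> {c..d})"
      "\<And>a b. a \<le> x \<Longrightarrow> x \<le> b \<Longrightarrow> b - a < d2 \<Longrightarrow> lifts_on C p h ({a..b} \<times> {d..e})"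
      by metis
    have "lifts_on C p h ({a..b} \<times> {c..e})" if ab: "a \<le> x" "x \<le> b" "b - a < min d1 d2" for a b
    proof -
      have "lifts_on C p h ({a..b} \<times> {c..d} \<union> {a..b} \<times> {d..e})"
      proof (rule lifts_on_Un[OF cov])
        have "{a..b} \<times> {c..d} \<inter> {a..b} \<times> {d..e} = {a..b} \<times> {d}"
          using trans by auto
        then show "connected ({a..b} \<times> {c..d} \<inter> {a..b} \<times> {d..e})" "{a..b} \<times> {c..d} \<inter> {a..b} \<times> {d..e} \<noteq> {}"
          using ab by (auto intro: connected_Times)
      qed (use d ab in \<open>auto intro: closed_Times\<close>)
      moreover have "{a..b} \<times> {c..d} \<union> {a..b} \<times> {d..e} = {a..b} \<times> {c..e}"
        using trans by auto
      ultimately show ?thesis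
        by simp
    qed
    then show ?case
      using d(1,2) by (intro exI[of _ "min d1 d2"]) auto
  next
    case (local y)
    obtain W where W: "open W" "(x,y) \<in> W" "\<And>K. K \<subseteq> W \<Longrightarrow> lifts_on C p h K"
      using lifts_on_locally[OF cov h] by blast
    obtain A B where AB: "open A" "open B" "(x,y) \<in> A \<times> B" "A \<times> B \<subseteq> W"
      using open_prod_elim[OF W(1,2)] by metis
    obtain e1 e2 where e: "e1 > 0" "ball x e1 \<subseteq> A" "e2 > 0" "ball y e2 \<subseteq> B"
      using AB by (metis mem_Sigma_iff open_contains_ball)
    have "lifts_on C p h ({a..b} \<times> {c..d})"
      if "a \<le> x" "x \<le> b" "b - a < e1" "c \<le> y" "y \<le> d" "d - c < e2" for a b c d
    proof (rule W(3))
      have "{a..b} \<subseteq> ball x e1" "{c..d} \<subseteq> ball y e2"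
        using that by (auto simp: dist_real_def)
      then show "{a..b} \<times> {c..d} \<subseteq> W"
        using e AB by blast
    qed
    then show ?case
      using e by blast
  qed
qed

lemma covering_space_lift_square:
  fixes h :: "real \<times> real \<Rightarrow> 'a::topological_space"
  assumes cov: "covering_space C p X"
    and h: "continuous_on ({0..1} \<times> {0..1}) h" "h ` ({0..1} \<times> {0..1}) \<subseteq> X"
    and a: "a \<in> C" "p a = h (0,0)"
  obtains k where "continuous_on ({0..1} \<times> {0..1}) k" "k ` ({0..1} \<times> {0..1}) \<subseteq> C" "k (0,0) = a"
    "\<And>z. z \<in> {0..1} \<times> {0..1} \<Longrightarrow> p (k z) = h z"
proof -
  \<comment> \<open>\<open>r\<close> clamps both coordinates to the unit interval, so it retracts
    the plane onto the square. Thus \<open>h \<circ> r\<close> is defined on the whole plane, as the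
    local lemma demands, and equals \<open>h\<close> on the square.\<close>
  define r :: "real \<times> real \<Rightarrow> real \<times> real"
    where "r z = (max 0 (min 1 (fst z)), max 0 (min 1 (snd z)))" for z
  have r: "r z \<in> {0..1} \<times> {0..1}" "z \<in> {0..1} \<times> {0..1} \<Longrightarrow> r z = z" for z
    unfolding r_def by auto
  have "continuous_on UNIV r"
    unfolding r_def by (intro continuous_intros)
  then have hr: "continuous_on UNIV (h \<circ> r)"
    using r(1) by (intro continuous_on_compose continuous_on_subset[OF h(1)]) blast+
  have "range (h \<circ> r) \<subseteq> X"
    using r(1) h(2) by force
  then have "lifts_on C p (h \<circ> r) ({0..1} \<times> {0..1})"
    by (intro lifts_on_rectangle[OF cov hr]) auto
  then obtain k where "continuous_on ({0..1} \<times> {0..1}) k" "k ` ({0..1} \<times> {0..1}) \<subseteq> C" "k (0,0) = a"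
    "\<And>z. z \<in> {0..1} \<times> {0..1} \<Longrightarrow> p (k z) = (h \<circ> r) z"
    using a r(2)[of "(0,0)"] by (auto elim: lifts_onE[of C p "h \<circ> r" "{0..1} \<times> {0..1}" "(0,0)" a])
  then show ?thesis
    using that[of k] r(2) by simp
qed

text \<open>The path is treated as a map of the square that ignores the second coordinate; the lift
  of that map is restricted to the edge where this coordinate is 0.\<close>

lemma covering_space_lift_path_topological:
  fixes g :: "real \<Rightarrow> 'a::topological_space"
  assumes cov: "covering_space C p X" and g: "path g" "path_image g \<subseteq> X"
    and a: "a \<in> C" "p a = pathstart g"
  obtains g' where "path g'" "path_image g' \<subseteq> C" "pathstart g' = a" "\<And>t. t \<in> {0..1} \<Longrightarrow> p (g' t) = g t"
proof -
  have "continuous_on ({0..1} \<times> {0..1::real}) (g \<circ> fst)"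
    using g(1) unfolding path_def
    by (intro continuous_on_compose continuous_intros) (auto intro: continuous_on_subset)
  moreover have "(g \<circ> fst) ` ({0..1} \<times> {0..1::real}) \<subseteq> X"
    using g(2) by (auto simp: path_image_def)
  moreover have "p a = (g \<circ> fst) (0, 0)"
    using a by (simp add: pathstart_def)
  ultimately obtain k :: "real \<times> real \<Rightarrow> _" where k: "continuous_on ({0..1} \<times> {0..1}) k" "k ` ({0..1} \<times> {0..1}) \<subseteq> C" "k (0,0) = a"
    "\<And>z. z \<in> {0..1} \<times> {0..1} \<Longrightarrow> p (k z) = (g \<circ> fst) z"
    using covering_space_lift_square[OF cov _ _ a(1), of "g \<circ> fst"] by metis
  show ?thesis
  proof (rule that[of "\<lambda>t. k (t, 0)"])
    show "path (\<lambda>t. k (t, 0))"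
      unfolding path_def by (rule continuous_on_compose2[OF k(1)]) (auto intro!: continuous_intros)
  qed (use k in \<open>auto simp: path_image_def pathstart_def\<close>)
qed

text \<open>The homotopy lifts to \<open>k\<close> on the square, and uniqueness of lifts identifies
  all four edges. Those on which the homotopy stays at an endpoint lift to constants, the other two
  are \<open>h1\<close> and \<open>h2\<close>; hence the two lifts end at the same corner
  value.\<close>

lemma covering_space_monodromy_topological:
  fixes g1 g2 :: "real \<Rightarrow> 'a::topological_space"
  assumes cov: "covering_space C p X" and hom: "homotopic_paths X g1 g2"
    and h1: "path h1" "path_image h1 \<subseteq> C" "\<And>t. t \<in> {0..1} \<Longrightarrow> p (h1 t) = g1 t"
    and h2: "path h2" "path_image h2 \<subseteq> C" "\<And>t. t \<in> {0..1} \<Longrightarrow> p (h2 t) = g2 t"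
    and start: "pathstart h1 = pathstart h2"
  shows "pathfinish h1 = pathfinish h2"
proof -
  obtain h :: "real \<times> real \<Rightarrow> 'a" where h: "continuous_on ({0..1} \<times> {0..1}) h" "h ` ({0..1} \<times> {0..1}) \<subseteq> X"
    and h_eq: "\<And>x. x \<in> {0..1} \<Longrightarrow> h (0,x) = g1 x" "\<And>x. x \<in> {0..1} \<Longrightarrow> h (1,x) = g2 x"
      "\<And>t. t \<in> {0..1} \<Longrightarrow> h (t,0) = g1 0" "\<And>t. t \<in> {0..1} \<Longrightarrow> h (t,1) = g1 1"
    using hom unfolding homotopic_paths pathstart_def pathfinish_def o_def image_subset_iff_funcset by metis
  have im: "h1 ` {0..1} \<subseteq> C" "h2 ` {0..1} \<subseteq> C"
    using h1 h2 by (auto simp: path_image_def)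
  have "h1 0 \<in> C" "p (h1 0) = h (0,0)"
    using im h1(3) h_eq by auto
  then obtain k where k: "continuous_on ({0..1} \<times> {0..1}) k" "k ` ({0..1} \<times> {0..1}) \<subseteq> C" "k (0,0) = h1 0"
    "\<And>z. z \<in> {0..1} \<times> {0..1} \<Longrightarrow> p (k z) = h z"
    using covering_space_lift_square[OF cov h] by metis
  have row: "continuous_on {0..1} (\<lambda>x. k (t, x))" "(\<lambda>x. k (t, x)) ` {0..1} \<subseteq> C"
    and col: "continuous_on {0..1} (\<lambda>x. k (x, t))" "(\<lambda>x. k (x, t)) ` {0..1} \<subseteq> C" if "t \<in> {0..1}" for t
    using that k(2) by (auto intro!: continuous_on_compose2[OF k(1)] continuous_intros)
  have I: "connected {0..1::real}"
    by simp
  have const: "continuous_on {0..1::real} (\<lambda>_. c)" for c :: 'b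
    by simp
  \<comment> \<open>This corner comes first because comparing \<open>h2\<close> with the edge
    \<open>k (1, _)\<close> needs a common starting value.\<close>
  have "k (1,0) = k (0,0)"
    by (rule covering_space_lift_unique_topological[OF cov I col[of 0] const, of _ 0])
      (use k h_eq h1(3)[of 0] im in auto)
  have "k (1,1) = k (0,1)"
    by (rule covering_space_lift_unique_topological[OF cov I col[of 1] const, of _ 0])
      (use k h_eq in auto)
  moreover have "k (0,1) = h1 1"
    by (rule covering_space_lift_unique_topological[OF cov I row[of 0] _ im(1), of 0])
      (use k h_eq h1 in \<open>auto simp: path_def\<close>)
  moreover have "k (1,1) = h2 1"
    by (rule covering_space_lift_unique_topological[OF cov I row[of 1] _ im(2), of 0])
      (use k h_eq h2 start \<open>k (1,0) = k (0,0)\<close> in \<open>auto simp: path_def pathstart_def\<close>)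
  ultimately show ?thesis
    by (simp add: pathfinish_def)
qed

section \<open>From free homotopies of loops to homotopies of paths relative to endpoints\<close>

section \<open>Paths in simply connected spaces\<close>

text \<open>\<open>simply_connected\<close> only provides a free homotopy of loops, during which the
  base point may move. The path \<open>h (t, 0)\<close> traced by the base point is run through
  forwards and, after a constant stretch, backwards, so it cancels and a homotopy with fixed
  endpoints remains.\<close>

lemma simply_connected_imp_homotopic_paths:
  fixes S :: "'a::topological_space set"
  assumes S: "simply_connected S" and w: "path w" "path_image w \<subseteq> S" and v: "path v" "path_image v \<subseteq> S"
    and ends: "pathstart w = pathstart v" "pathfinish w = pathfinish v"
  shows "homotopic_paths S w v"
proof -
  let ?l = "w +++ reversepath v"
  let ?I = "{0..1::real}"
  have "homotopic_loops S ?l (\<lambda>_. w 0)"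
  proof -
    have "path ?l" "path_image ?l \<subseteq> S" "pathfinish ?l = pathstart ?l"
      using w v ends by (auto simp: path_image_join)
    moreover have "path (\<lambda>_. w 0)" "path_image (\<lambda>_. w 0) \<subseteq> S" "pathfinish (\<lambda>_. w 0) = pathstart (\<lambda>_. w 0)"
      using w by (auto simp: path_def path_image_def pathstart_def pathfinish_def)
    ultimately show ?thesis
      using S unfolding simply_connected_def by blast
  qed
  then obtain h where h: "continuous_on (?I \<times> ?I) h" "h \<in> ?I \<times> ?I \<rightarrow> S"
    and h0: "\<And>x. x \<in> ?I \<Longrightarrow> h (0,x) = ?l x" and h1: "\<And>x. x \<in> ?I \<Longrightarrow> h (1,x) = w 0"
    and hloop: "\<And>t. t \<in> ?I \<Longrightarrow> h (t,1) = h (t,0)"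
    unfolding homotopic_loops by (auto simp: pathstart_def pathfinish_def)
  have hw: "h (0, x / 2) = w x" if "x \<in> ?I" for x
    using that h0[of "x / 2"] by (auto simp: joinpaths_def)
  have hv: "h (0, 1 - x / 2) = v x" if "x \<in> ?I" for x
  \<comment> \<open>At \<open>x = 1\<close> the parameter is 1/2, where \<open>joinpaths\<close>
    still takes its first branch; the value comes from \<open>w\<close>, and the common endpoint
    turns it into \<open>v 1\<close>.\<close>
  proof (cases "x = 1")
    case True
    then show ?thesis
      using hw[of 1] ends by (simp add: pathfinish_def)
  next
    case False
    then show ?thesis
      using that h0[of "1 - x / 2"] by (auto simp: joinpaths_def reversepath_def)
  qed
  \<comment> \<open>Both A and B run from (0,0) to (0,1/2), B the long way round the square. By the loop
    condition, h composed with B factors through the interval [-1,1] as g composed with b.\<close>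
  define A :: "real \<Rightarrow> real \<times> real" where "A s = (0, s / 2)" for s
  define b :: "real \<Rightarrow> real" where "b s = max (max (- 4 * s) (- 1)) (4 * s - 3)" for s
  define B :: "real \<Rightarrow> real \<times> real" where
    "B s = (max 0 (- b s), max 0 (min (min 1 (4 * s - 1)) ((5 - 4 * s) / 2)))" for s
  define g where "g r = (if r \<le> 0 then h (- r, 0) else h (0, 1 - r / 2))" for r
  have contg: "continuous_on {-1..1} g"
  proof -
    have "continuous_on {-1..0} (\<lambda>r. h (- r, 0))" "continuous_on {0..1} (\<lambda>r. h (0, 1 - r / 2))"
      by (auto intro!: continuous_on_compose2[OF h(1)] continuous_intros)
    then have "continuous_on ({-1..0} \<union> {0..1}) g"
      unfolding g_def by (intro continuous_on_cases) (use hloop[of 0] in auto)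
    moreover have "{-1..0} \<union> {0..1} = {-1..1::real}"
      by auto
    ultimately show ?thesis
      by simp
  qed
  have gS: "g \<in> {-1..1} \<rightarrow> S"
    using h(2) by (auto simp: g_def Pi_iff)
  have b: "path b" "path_image b \<subseteq> {-1..1}"
    unfolding path_def b_def path_image_def by (auto intro!: continuous_intros)
  have AB: "path A" "path B" "A ` ?I \<subseteq> ?I \<times> ?I" "B ` ?I \<subseteq> ?I \<times> ?I"
    unfolding path_def A_def B_def b_def by (auto intro!: continuous_intros)
  have "homotopic_paths (?I \<times> ?I) A B"
  proof (rule homotopic_paths_linear[OF AB(1,2)])
    show "closed_segment (A t) (B t) \<subseteq> ?I \<times> ?I" if "t \<in> ?I" for t
      using AB(3,4) that by (intro closed_segment_subset convex_Times) auto
  qed (auto simp: A_def B_def b_def pathstart_def pathfinish_def)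
  then have hAB: "homotopic_paths S (h \<circ> A) (h \<circ> B)"
    by (rule homotopic_paths_continuous_image[OF _ h])
  have hB: "h (B s) = g (b s)" if s: "s \<in> ?I" for s
  proof -
    \<comment> \<open>The four legs of \<open>B\<close>: out along the edge with second coordinate
      0, up the edge on which \<open>h\<close> is constantly \<open>w 0\<close>, back along the edge
      with second coordinate 1, and down from (0,1) to (0,1/2), where \<open>h\<close> traces
      \<open>v\<close>.\<close>
    consider "s \<le> 1/4" | "1/4 \<le> s" "s \<le> 1/2" | "1/2 \<le> s" "s \<le> 3/4" | "3/4 < s"
      by linarith
    then show ?thesis
    proof cases
      case 1
      then have "b s = - 4 * s" "B s = (4 * s, 0)"
        using s by (auto simp: B_def b_def)
      then show ?thesis
        using s by (simp add: g_def)
    next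
      case 2
      then have "b s = - 1" "B s = (1, 4 * s - 1)"
        by (auto simp: B_def b_def)
      then show ?thesis
        using 2 h1[of 0] h1[of "4 * s - 1"] by (simp add: g_def)
    next
      case 3
      then have "b s = 4 * s - 3" "B s = (3 - 4 * s, 1)"
        by (auto simp: B_def b_def)
      then show ?thesis
        using 3 hloop[of "3 - 4 * s"] by (simp add: g_def)
    next
      case 4
      then have "b s = 4 * s - 3" "B s = (0, (5 - 4 * s) / 2)"
        using s by (auto simp: B_def b_def)
      then show ?thesis
        using 4 by (simp add: g_def diff_divide_distrib)
    qed
  qed
  \<comment> \<open>\<open>b\<close> goes from 0 to -1, waits, returns to 0 and goes on to 1.
    Convexity of the interval removes this detour while fixing the endpoints 0 and 1; what is left
    is \<open>g\<close> on the unit interval, which is \<open>v\<close>.\<close>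
  have "homotopic_paths {-1..1} b (\<lambda>s. s)"
  proof (rule homotopic_paths_linear[OF b(1)])
    show "closed_segment (b t) t \<subseteq> {-1..1}" if "t \<in> ?I" for t
      using b(2) that by (intro closed_segment_subset) (auto simp: path_image_def image_subset_iff)
  qed (auto simp: b_def pathstart_def pathfinish_def path_def)
  then have gb: "homotopic_paths S (g \<circ> b) (g \<circ> (\<lambda>s. s))"
    by (rule homotopic_paths_continuous_image[OF _ contg gS])
  have "homotopic_paths S w (h \<circ> A)"
    by (rule homotopic_paths_eq[OF w]) (use hw in \<open>auto simp: A_def\<close>)
  also note hAB
  also have "homotopic_paths S (h \<circ> B) (g \<circ> b)"
    by (rule homotopic_paths_eq)
      (use homotopic_paths_imp_path[OF hAB] homotopic_paths_imp_subset[OF hAB] hB in auto)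
  also note gb
  also have "homotopic_paths S (g \<circ> (\<lambda>s. s)) v"
  proof (rule homotopic_paths_sym[OF homotopic_paths_eq[OF v]])
    fix t assume "t \<in> ?I"
    then show "v t = (g \<circ> (\<lambda>s. s)) t"
      using hv[of t] hv[of 0] hloop[of 0] by (auto simp: g_def)
  qed
  finally show ?thesis .
qed

section \<open>Subdividing a lifted path by sheets, and paths that follow it\<close>

section \<open>Tubes around a path\<close>

text \<open>The neighbourhoods \<open>V x\<close> pull back along \<open>g\<close> to an open cover
  of the compact unit interval. Equal segments shorter than its Lebesgue number each lie in one
  member; \<open>z i\<close> is the centre of the neighbourhood chosen for segment
  \<open>i\<close>.\<close>

lemma path_equipartition:
  fixes g :: "real \<Rightarrow> 'a::topological_space"
  assumes g: "path g" "path_image g \<subseteq> C"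
    and nbhd: "\<And>x. x \<in> C \<Longrightarrow> x \<in> V x \<and> openin (top_of_set C) (V x)"
  obtains n :: nat and z :: "nat \<Rightarrow> 'a" where "0 < n"
    "\<And>i. i < n \<Longrightarrow> z i \<in> C \<and> g ` {real i / n..real (Suc i) / n} \<subseteq> V (z i)"
proof -
  have "\<exists>W. open W \<and> s \<in> W \<and> g ` ({0..1} \<inter> W) \<subseteq> V (g s)" if s: "s \<in> {0..1}" for s
  proof -
    have gs: "g s \<in> C"
      using g(2) s by (auto simp: path_image_def)
    then obtain O' where O': "open O'" "V (g s) = C \<inter> O'"
      using nbhd by (metis openin_open)
    obtain W where "open W" "W \<inter> {0..1} = g -` O' \<inter> {0..1}"
      using g(1) O'(1) unfolding path_def continuous_on_open_invariant by auto
    then show ?thesis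
      using s gs O' g(2) nbhd[OF gs] by (intro exI[of _ W]) (auto simp: path_image_def)
  qed
  then obtain W where W: "\<And>s. s \<in> {0..1} \<Longrightarrow> open (W s) \<and> s \<in> W s \<and> g ` ({0..1} \<inter> W s) \<subseteq> V (g s)"
    by metis
  obtain \<delta> where \<delta>: "0 < \<delta>" "\<And>T. T \<subseteq> {0..1} \<Longrightarrow> diameter T < \<delta> \<Longrightarrow> \<exists>B\<in>W ` {0..1}. T \<subseteq> B"
    by (rule Lebesgue_number_lemma[of "{0..1}" "W ` {0..1}"]) (use W in auto)
  obtain m where m: "1 / real (Suc m) < \<delta>"
    using \<delta>(1) nat_approx_posE by blast
  let ?n = "Suc m"
  have "\<exists>z. z \<in> C \<and> g ` {real i / ?n..real (Suc i) / ?n} \<subseteq> V z" if i: "i < ?n" for i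
  proof -
    have sub: "{real i / ?n..real (Suc i) / ?n} \<subseteq> {0..1}"
    proof -
      have "0 \<le> real i / ?n" "real (Suc i) / ?n \<le> 1"
        using i by (auto simp: field_simps)
      then show ?thesis
        by (metis atLeastatMost_subset_iff)
    qed
    have "real (Suc i) / ?n - real i / ?n = 1 / ?n"
      by (simp add: field_simps)
    moreover have "real i / ?n \<le> real (Suc i) / ?n"
      by (intro divide_right_mono) auto
    ultimately have "diameter {real i / ?n..real (Suc i) / ?n} < \<delta>"
      using m by (simp only: diameter_closed_interval not_less[symmetric] if_False)
    then obtain s where "s \<in> {0..1}" "{real i / ?n..real (Suc i) / ?n} \<subseteq> W s"
      using \<delta>(2)[OF sub] by auto
    then show ?thesis
      using W[of s] sub g(2) by (intro exI[of _ "g s"]) (auto simp: path_image_def image_subset_iff subset_iff)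
  qed
  then obtain z where "\<And>i. i < ?n \<Longrightarrow> z i \<in> C \<and> g ` {real i / ?n..real (Suc i) / ?n} \<subseteq> V (z i)"
    by metis
  then show ?thesis
    using that[of ?n z] by simp
qed

lemma covering_space_path_tube:
  fixes w :: "real \<Rightarrow> 'a::topological_space"
  assumes cov: "covering_space C p X"
    and w': "path w'" "path_image w' \<subseteq> C" "\<And>s. s \<in> {0..1} \<Longrightarrow> p (w' s) = w s"
  obtains t :: "nat \<Rightarrow> real" and n :: nat and U :: "nat \<Rightarrow> 'a set"
  where "t 0 = 0" "t n = 1" "\<forall>i<n. t i < t (Suc i)"
    "\<forall>i<n. openin (top_of_set X) (U i) \<and> w ` {t i..t (Suc i)} \<subseteq> U i"
    "\<forall>u u'. path u' \<and> path_image u' \<subseteq> C \<and> pathstart u' = pathstart w' \<and> (\<forall>s\<in>{0..1}. p (u' s) = u s) \<and>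
       (\<forall>i<n. u ` {t i..t (Suc i)} \<subseteq> U i) \<and> (\<forall>i\<le>n. u (t i) = w (t i)) \<longrightarrow> pathfinish u' = pathfinish w'"
proof -
  have "\<exists>T u q. x \<in> T \<and> openin (top_of_set C) T \<and> openin (top_of_set X) u \<and> homeomorphism T u p q"
    if "x \<in> C" for x
    using covering_space_local_homeomorphism[OF cov that] by metis
  then obtain V N q where loc: "\<And>x. x \<in> C \<Longrightarrow> x \<in> V x \<and> openin (top_of_set C) (V x) \<and>
      openin (top_of_set X) (N x) \<and> homeomorphism (V x) (N x) p (q x)"
    by metis
  obtain n :: nat and z where n: "0 < n"
    and z: "\<And>i. i < n \<Longrightarrow> z i \<in> C \<and> w' ` {real i / n..real (Suc i) / n} \<subseteq> V (z i)"
    using path_equipartition[OF w'(1,2), of V] loc by metis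
  define t where "t i = real i / n" for i
  define U where "U i = N (z i)" for i
  have tI: "t i \<in> {0..1}" if "i \<le> n" for i
    using that n by (simp add: t_def)
  have tless: "t i < t (Suc i)" for i
    using n by (simp add: t_def divide_strict_right_mono)
  have tsub: "{t i..t (Suc i)} \<subseteq> {0..1}" if "i < n" for i
    using tI[of i] tI[of "Suc i"] that by auto
  have hom: "homeomorphism (V (z i)) (U i) p (q (z i))" and Vsub: "V (z i) \<subseteq> C" if "i < n" for i
    using loc[of "z i"] z[OF that] by (auto simp: U_def dest: openin_imp_subset)
  have wV: "w' s \<in> V (z i)" if "i < n" "s \<in> {t i..t (Suc i)}" for i s
    using z[OF that(1)] that(2) by (auto simp: t_def)
  show ?thesis
  proof (rule that[of t n U])
    show "t 0 = 0" "t n = 1"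
      using n by (auto simp: t_def)
    show "\<forall>i<n. t i < t (Suc i)"
      using tless by blast
    show "\<forall>i<n. openin (top_of_set X) (U i) \<and> w ` {t i..t (Suc i)} \<subseteq> U i"
    proof (intro allI impI conjI)
      fix i assume i: "i < n"
      show "openin (top_of_set X) (U i)"
        using loc z[OF i] by (simp add: U_def)
      show "w ` {t i..t (Suc i)} \<subseteq> U i"
      proof
        fix y assume "y \<in> w ` {t i..t (Suc i)}"
        then obtain s where s: "s \<in> {t i..t (Suc i)}" "y = w s"
          by auto
        then have "y = p (w' s)"
          using w'(3) tsub[OF i] by auto
        then show "y \<in> U i"
          using wV[OF i s(1)] hom[OF i] unfolding homeomorphism_def by auto
      qed
    qed
    show "\<forall>u u'. path u' \<and> path_image u' \<subseteq> C \<and> pathstart u' = pathstart w' \<and> (\<forall>s\<in>{0..1}. p (u' s) = u s) \<and>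
       (\<forall>i<n. u ` {t i..t (Suc i)} \<subseteq> U i) \<and> (\<forall>i\<le>n. u (t i) = w (t i)) \<longrightarrow> pathfinish u' = pathfinish w'"
    proof (intro allI impI, elim conjE)
      fix u u'
      assume u': "path u'" "path_image u' \<subseteq> C" "pathstart u' = pathstart w'" "\<forall>s\<in>{0..1}. p (u' s) = u s"
        and "\<forall>i<n. u ` {t i..t (Suc i)} \<subseteq> U i" "\<forall>i\<le>n. u (t i) = w (t i)"
      then have u: "\<And>i. i < n \<Longrightarrow> u ` {t i..t (Suc i)} \<subseteq> U i" "\<And>i. i \<le> n \<Longrightarrow> u (t i) = w (t i)"
        by blast+
      \<comment> \<open>Only the partition points are compared: between them \<open>u'\<close> and
        \<open>w'\<close> may differ, but both stay in the sheet \<open>V (z i)\<close>. Meeting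
        \<open>w\<close> at \<open>t (Suc i)\<close> brings \<open>u'\<close> back to
        \<open>w'\<close>, which also lies in the next sheet.\<close>
      have "u' (t i) = w' (t i)" if "i \<le> n" for i
        using that
      proof (induction i)
        case 0
        then show ?case
          using u'(3) by (simp add: t_def pathstart_def)
      next
        case (Suc i)
        then have i: "i < n"
          by simp
        let ?J = "{t i..t (Suc i)}"
        have qw: "q (z i) (w s) = w' s" if "s \<in> ?J" for s
          using hom[OF i] wV[OF i that] w'(3) tsub[OF i] that unfolding homeomorphism_def by force
        have ends: "t i \<in> ?J" "t (Suc i) \<in> ?J"
          using tless[of i] by auto
        have contu': "continuous_on {0..1} u'"
          using u'(1) by (simp add: path_def)
        \<comment> \<open>Continuity of \<open>u\<close> is inherited from its lift, since
          \<open>u\<close> equals \<open>p \<circ> u'\<close> on the unit interval.\<close>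
        have "continuous_on {0..1} u"
        proof (rule continuous_on_eq)
          show "continuous_on {0..1} (p \<circ> u')"
            using covering_space_imp_continuous[OF cov] u'(2)
            by (intro continuous_on_compose contu') (auto intro: continuous_on_subset simp: path_image_def)
        qed (use u'(4) in auto)
        \<comment> \<open>On this segment \<open>u'\<close> and \<open>q (z i) \<circ> u\<close>
          both lift \<open>u\<close>. They agree at \<open>t i\<close> by the induction hypothesis,
          because \<open>u\<close> and \<open>w\<close> coincide there and \<open>q (z i)\<close>
          takes \<open>w\<close> to \<open>w'\<close>.\<close>
        have "u' (t (Suc i)) = (q (z i) \<circ> u) (t (Suc i))"
        proof (rule covering_space_lift_unique_topological[OF cov, of ?J _ _ "t i"])
          show "continuous_on ?J u'"
            using contu' tsub[OF i] by (rule continuous_on_subset)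
          show "u' ` ?J \<subseteq> C"
            using u'(2) tsub[OF i] by (auto simp: path_image_def)
          show "continuous_on ?J (q (z i) \<circ> u)"
          proof (rule continuous_on_compose)
            show "continuous_on ?J u"
              using \<open>continuous_on {0..1} u\<close> tsub[OF i] by (rule continuous_on_subset)
            show "continuous_on (u ` ?J) (q (z i))"
              using hom[OF i] u(1)[OF i] unfolding homeomorphism_def by (metis continuous_on_subset)
          qed
          show "(q (z i) \<circ> u) ` ?J \<subseteq> C"
            using hom[OF i] u(1)[OF i] Vsub[OF i] unfolding homeomorphism_def by fastforce
          show "p (u' s) = p ((q (z i) \<circ> u) s)" if "s \<in> ?J" for s
          proof -
            have "p (q (z i) (u s)) = u s"
              using hom[OF i] u(1)[OF i] that unfolding homeomorphism_def by blast
            then show ?thesis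
              using u'(4) that tsub[OF i] by auto
          qed
          show "u' (t i) = (q (z i) \<circ> u) (t i)"
            using Suc i u(2)[of i] qw[OF ends(1)] by simp
        qed (use ends in auto)
        then show ?case
          using u(2)[OF Suc.prems] qw[OF ends(2)] by simp
      qed
      from this[of n] show "pathfinish u' = pathfinish w'"
        using n by (simp add: t_def pathfinish_def)
    qed
  qed
qed

section \<open>A simply connected covering forces the path Hausdorff property\<close>

theorem corollary3p3:
  fixes X :: "'a::topological_space set"
  assumes "path_connected X"
    and "\<not> homotopically_path_Hausdorff X"
  shows "\<not> (\<exists>(C :: 'b::topological_space set) (p :: 'b \<Rightarrow> 'a).
              covering_space C p X \<and> path_connected C \<and> simply_connected C)"
proof
  assume "\<exists>(C :: 'b::topological_space set) (p :: 'b \<Rightarrow> 'a).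
              covering_space C p X \<and> path_connected C \<and> simply_connected C"
  then obtain C :: "'b set" and p :: "'b \<Rightarrow> 'a" where cov: "covering_space C p X" and sc: "simply_connected C"
    by blast
  have "homotopically_path_Hausdorff X"
    unfolding homotopically_path_Hausdorff_def
  proof (intro allI impI, elim conjE)
    fix w v :: "real \<Rightarrow> 'a"
    assume w: "path w" "path_image w \<subseteq> X" and v: "path v" "path_image v \<subseteq> X"
      and ends: "pathstart w = pathstart v" "pathfinish w = pathfinish v"
      and nhom: "\<not> homotopic_paths X w v"
    obtain a where a: "a \<in> C" "p a = pathstart w"
      using covering_space_imp_surjective[OF cov] w(2) by (metis imageE pathstart_in_path_image subsetD)
    obtain w' where w': "path w'" "path_image w' \<subseteq> C" "pathstart w' = a" "\<And>s. s \<in> {0..1} \<Longrightarrow> p (w' s) = w s"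
      using covering_space_lift_path_topological[OF cov w a] by metis
    obtain v' where v': "path v'" "path_image v' \<subseteq> C" "pathstart v' = a" "\<And>s. s \<in> {0..1} \<Longrightarrow> p (v' s) = v s"
      using covering_space_lift_path_topological[OF cov v a(1)] a(2) ends(1) by metis
    \<comment> \<open>If the lifts ended together, simple connectedness would make them homotopic in
      \<open>C\<close>, and \<open>p\<close> would project this to a homotopy from \<open>w\<close>
      to \<open>v\<close>.\<close>
    have distinct_ends: "pathfinish w' \<noteq> pathfinish v'"
    proof
      assume "pathfinish w' = pathfinish v'"
      then have "homotopic_paths C w' v'"
        using simply_connected_imp_homotopic_paths[OF sc] w' v' by metis
      then have "homotopic_paths X (p \<circ> w') (p \<circ> v')"
        using covering_space_imp_continuous[OF cov] covering_space_imp_surjective[OF cov]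
        by (intro homotopic_paths_continuous_image) auto
      moreover have "homotopic_paths X w (p \<circ> w')"
        by (rule homotopic_paths_eq[OF w]) (use w'(4) in auto)
      moreover have "homotopic_paths X (p \<circ> v') v"
        by (rule homotopic_paths_sym[OF homotopic_paths_eq[OF v]]) (use v'(4) in auto)
      ultimately show False
        using nhom by (meson homotopic_paths_trans)
    qed
    \<comment> \<open>The tube depends on the lift \<open>w'\<close> alone; \<open>v\<close> enters
      only through the endpoint of \<open>v'\<close>.\<close>
    obtain t n U where tube: "t 0 = 0" "t n = 1" "\<forall>i<n. t i < t (Suc i)"
      "\<forall>i<n. openin (top_of_set X) (U i) \<and> w ` {t i..t (Suc i)} \<subseteq> U i"
      and tube_lift: "\<forall>u u'. path u' \<and> path_image u' \<subseteq> C \<and> pathstart u' = pathstart w' \<and> (\<forall>s\<in>{0..1}. p (u' s) = u s) \<and>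
       (\<forall>i<n. u ` {t i..t (Suc i)} \<subseteq> U i) \<and> (\<forall>i\<le>n. u (t i) = w (t i)) \<longrightarrow> pathfinish u' = pathfinish w'"
      by (rule covering_space_path_tube[OF cov w'(1,2,4)])
    have "\<not> homotopic_paths X u v"
      if u: "path u" "path_image u \<subseteq> X" and uU: "\<forall>i<n. u ` {t i..t (Suc i)} \<subseteq> U i"
        and ut: "\<forall>i\<le>n. u (t i) = w (t i)" for u
    proof
      assume hom: "homotopic_paths X u v"
      then have "p a = pathstart u"
        using a(2) ends(1) homotopic_paths_imp_pathstart by metis
      then obtain u' where u': "path u'" "path_image u' \<subseteq> C" "pathstart u' = a" "\<And>s. s \<in> {0..1} \<Longrightarrow> p (u' s) = u s"
        using covering_space_lift_path_topological[OF cov u a(1)] by metis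
      have "pathfinish u' = pathfinish v'"
        using covering_space_monodromy_topological[OF cov hom] u' v' by metis
      moreover have "pathfinish u' = pathfinish w'"
        by (rule tube_lift[THEN spec[of _ u], THEN spec[of _ u'], THEN mp]) (use u' w'(3) uU ut in simp)
      ultimately show False
        using distinct_ends by simp
    qed
    with tube show "\<exists>(n::nat) (t :: nat \<Rightarrow> real) (U :: nat \<Rightarrow> 'a set).
          t 0 = 0 \<and> t n = 1 \<and> (\<forall>i<n. t i < t (Suc i)) \<and>
          (\<forall>i<n. openin (top_of_set X) (U i) \<and> w ` {t i..t (Suc i)} \<subseteq> U i) \<and>
          (\<forall>u. path u \<and> path_image u \<subseteq> X \<and>
               (\<forall>i<n. u ` {t i..t (Suc i)} \<subseteq> U i) \<and> (\<forall>i\<le>n. u (t i) = w (t i))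
               \<longrightarrow> \<not> homotopic_paths X u v)"
      by (intro exI[of _ n] exI[of _ t] exI[of _ U] conjI) (assumption | blast)+
  qed
  with assms(2) show False
    by simp
qed

end
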